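(* For $k\ge 1$ define $$v_1^{(k)}=\alpha(\boldsymbol 1_{2^k}\otimes Q_0^{\mathsf T}v_1)+[Q_0,Q_1,\dots,Q_{2^k-1}]^{\mathsf T}u_1+\gamma\,[0,\,Q_0,\,Q_0+Q_1,\dots,Q_0+Q_1+\dots+Q_{2^k-2}]^{\mathsf T}D_\alpha^{-1}v_1,$$ $$v_2^{(k)}=\beta(\boldsymbol 1_{2^k}\otimes V_0^{\mathsf T}v_2)+[V_0,V_1,\dots,V_{2^k-1}]^{\mathsf T}u_2+\gamma\,[0,\,V_0,\,V_0+V_1,\dots,V_0+V_1+\dots+V_{2^k-2}]^{\mathsf T}A_\beta^{-1}v_2.$$ Then $$\begin{bmatrix}-Y_k&I\\ I&-Z_k\end{bmatrix}\begin{bmatrix}\boldsymbol 1_{2^k}\otimes C_r^{\mathsf T}u_2\\ \boldsymbol 1_{2^k}\otimes B_r^{\mathsf T}u_1\end{bmatrix}=\begin{bmatrix}v_1^{(k)}\\ v_2^{(k)}\end{bmatrix}.$$ Moreover, $$(I-Y_kZ_k)(\boldsymbol 1_{2^k}\otimes B_r^{\mathsf T}u_1)=v_1^{(k)}+Y_kv_2^{(k)},\qquad (I-Z_kY_k)(\boldsymbol 1_{2^k}\otimes C_r^{\mathsf T}u_2)=v_2^{(k)}+Z_kv_1^{(k)}.$$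
   Context: Inequalities between matrices are entrywise; $\otimes$ is the Kronecker product; $\boldsymbol 1_l\in\mathbb R^l$ is the all-ones vector. An M-matrix is a real square matrix of the form $sI-N$ with $N\ge 0$ and $s\ge\rho(N)$ (spectral radius); it is nonsingular iff $s>\rho(N)$ for such a representation. Standing assumptions: $A\in\mathbb R^{m\times m}$, $D\in\mathbb R^{n\times n}$, $B\in\mathbb R^{m\times n}$, $C\in\mathbb R^{n\times m}$ are such that $W=\begin{bmatrix}D&-C\\ -B&A\end{bmatrix}$ is a nonsingular M-matrix or an irreducible singular M-matrix. Vectors $0<u_1\in\mathbb R^n$, $0<u_2\in\mathbb R^m$, $0\le v_1\in\mathbb R^n$, $0\le v_2\in\mathbb R^m$ are given with $W\begin{bmatrix}u_1\\ u_2\end{bmatrix}=\begin{bmatrix}v_1\\ v_2\end{bmatrix}$. There are full rank factorizations $B=B_lB_r^{\mathsf T}$, $C=C_lC_r^{\mathsf T}$ with $0\le B_l\in\mathbb R^{m\times p}$, $0\le B_r\in\mathbb R^{n\times p}$, $0\le C_l\in\mathbb R^{n\times q}$, $0\le C_r\in\mathbb R^{m\times q}$ (all of full column rank). The parameters satisfy $0\le\alpha\le\min_i a_{ii}^{-1}$, $0\le\beta\le\min_j d_{jj}^{-1}$, $\max\{\alpha,\beta\}>0$, where $a_{ii},d_{jj}$ are the diagonal entries of $A$ and $D$. Put $\gamma=\alpha+\beta$. For a real number $t$ write $A_t:=tA+I_m$ and $D_t:=tD+I_n$. Define $A_{\alpha,\beta}=A_\beta^{-1}A_{-\alpha}$,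 $D_{\alpha,\beta}=D_\alpha^{-1}D_{-\beta}$, $$U_0=A_\beta^{-1}B_l,\quad V_0=A_\beta^{-\mathsf T}C_r,\quad W_0=D_\alpha^{-1}C_l,\quad Q_0=D_\alpha^{-\mathsf T}B_r,$$ $$Y_0=\alpha B_r^{\mathsf T}D_\alpha^{-1}C_l\in\mathbb R^{p\times q},\quad Z_0=\beta C_r^{\mathsf T}A_\beta^{-1}B_l\in\mathbb R^{q\times p},$$ and for $j\ge 1$: $U_j=A_{\alpha,\beta}U_{j-1}$, $V_j=A_{\alpha,\beta}^{\mathsf T}V_{j-1}$, $W_j=D_{\alpha,\beta}W_{j-1}$, $Q_j=D_{\alpha,\beta}^{\mathsf T}Q_{j-1}$. For $k\ge 0$ let $\check U_k=[U_0,\dots,U_{2^k-1}]$, $\check V_k=[V_0,\dots,V_{2^k-1}]$, $\check W_k=[W_0,\dots,W_{2^k-1}]$, $\check Q_k=[Q_0,\dots,Q_{2^k-1}]$, $T_k=\check Q_k^{\mathsf T}\check W_k$, $S_k=\check V_k^{\mathsf T}\check U_k$, and for $k\ge 1$ $$Y_k=\begin{bmatrix}0&Y_{k-1}\\ Y_{k-1}&\gamma T_{k-1}\end{bmatrix},\qquad Z_k=\begin{bmatrix}0&Z_{k-1}\\ Z_{k-1}&\gamma S_{k-1}\end{bmatrix}.$$ Identity and zero blocks have the sizes dictated by the context. *)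

theory Defs
  imports
    "Jordan_Normal_Form.Matrix"
    "Jordan_Normal_Form.Gauss_Jordan_Elimination"
    "Jordan_Normal_Form.DL_Rank"
    "Jordan_Normal_Form.Spectral_Radius"
    "HOL-Combinatorics.Permutations"
begin

text \<open>\<open>mat_inverse\<close> returns an option; the value of \<open>minv\<close> is unspecified on singular
  (or non-square) matrices.\<close>

definition minv :: "real mat \<Rightarrow> real mat" where
  "minv A = the (mat_inverse A)"

definition M_matrix_repr :: "nat \<Rightarrow> real mat \<Rightarrow> real \<Rightarrow> real mat \<Rightarrow> bool" where
  "M_matrix_repr n M s N \<longleftrightarrow>
     N \<in> carrier_mat n n \<and> 0\<^sub>m n n \<le> N \<and>
     spectral_radius (map_mat complex_of_real N) \<le> s \<and>
     M = s \<cdot>\<^sub>m 1\<^sub>m n - N"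

definition M_matrix :: "nat \<Rightarrow> real mat \<Rightarrow> bool" where
  "M_matrix n M \<longleftrightarrow> (\<exists>s N. M_matrix_repr n M s N)"

definition nonsingular_M_matrix :: "nat \<Rightarrow> real mat \<Rightarrow> bool" where
  "nonsingular_M_matrix n M \<longleftrightarrow>
     (\<exists>s N. M_matrix_repr n M s N \<and> spectral_radius (map_mat complex_of_real N) < s)"

definition singular_M_matrix :: "nat \<Rightarrow> real mat \<Rightarrow> bool" where
  "singular_M_matrix n M \<longleftrightarrow> M_matrix n M \<and> \<not> nonsingular_M_matrix n M"

text \<open>Reducible: some simultaneous permutation of rows and columns yields a block upper
  triangular matrix with two nonempty square diagonal blocks. Under this definition every
  1-by-1 matrix is irreducible.\<close>

definition reducible_mat :: "nat \<Rightarrow> real mat \<Rightarrow> bool" where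
  "reducible_mat n M \<longleftrightarrow>
     (\<exists>\<pi> r E F G. \<pi> permutes {..<n} \<and> 0 < r \<and> r < n \<and>
        E \<in> carrier_mat r r \<and> F \<in> carrier_mat r (n - r) \<and> G \<in> carrier_mat (n - r) (n - r) \<and>
        mat n n (\<lambda>(i, j). M $$ (\<pi> i, \<pi> j)) = four_block_mat E F (0\<^sub>m (n - r) r) G)"

definition irreducible_mat :: "nat \<Rightarrow> real mat \<Rightarrow> bool" where
  "irreducible_mat n M \<longleftrightarrow> M \<in> carrier_mat n n \<and> \<not> reducible_mat n M"

definition full_column_rank :: "real mat \<Rightarrow> bool" where
  "full_column_rank M \<longleftrightarrow> vec_space.rank (dim_row M) M = dim_col M"

definition ones_vec :: "nat \<Rightarrow> real vec" where
  "ones_vec l = vec l (\<lambda>_. 1)"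

definition kron_vec :: "real vec \<Rightarrow> real vec \<Rightarrow> real vec" (infixl \<open>\<otimes>\<^sub>v\<close> 75) where
  "x \<otimes>\<^sub>v y = vec (dim_vec x * dim_vec y) (\<lambda>i. x $ (i div dim_vec y) * y $ (i mod dim_vec y))"

text \<open>\<open>shift t M\<close> is $M_t = tM + I$.\<close>

definition shift :: "real \<Rightarrow> real mat \<Rightarrow> real mat" where
  "shift t M = t \<cdot>\<^sub>m M + 1\<^sub>m (dim_row M)"

text \<open>\<open>block_row F l\<close> is $[F_0, F_1, \dots, F_{l-1}]$; all blocks are meant to have the size
  of $F_0$.\<close>

definition block_row :: "(nat \<Rightarrow> real mat) \<Rightarrow> nat \<Rightarrow> real mat" where
  "block_row F l = (let c = dim_col (F 0) in
     mat (dim_row (F 0)) (l * c) (\<lambda>(i, j). F (j div c) $$ (i, j mod c)))"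

text \<open>\<open>partial_sum F j\<close> is $F_0 + \dots + F_{j-1}$.\<close>

primrec partial_sum :: "(nat \<Rightarrow> real mat) \<Rightarrow> nat \<Rightarrow> real mat" where
  "partial_sum F 0 = 0\<^sub>m (dim_row (F 0)) (dim_col (F 0))"
| "partial_sum F (Suc j) = partial_sum F j + F j"

end

theory Submission
  imports Defs
begin

text \<open>
  The halves of the block system exchange under \<open>D \<leftrightarrow> A\<close>, \<open>B \<leftrightarrow> C\<close>, \<open>\<alpha> \<leftrightarrow> \<beta>\<close>, so consider the first,
  \<open>1 \<otimes> Br\<^sup>T u1 - Y\<^sub>k (1 \<otimes> Cr\<^sup>T u2) = v1\<^sup>(\<^sup>k\<^sup>)\<close>. It follows from the recursion for \<open>Y\<^sub>k\<close> and from the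
  single relation \<open>D u1 = v1 + C u2\<close> once \<open>D\<^sub>\<alpha> = \<alpha> D + I\<close> is known to be invertible.

  Invertibility. \<open>D\<close> is a diagonal block of an M-matrix, so its off-diagonal entries are nonpositive.
  Since \<open>D u1 = v1 + C u2 \<ge> 0\<close>, the vector \<open>D\<^sub>\<alpha> u1 = \<alpha> D u1 + u1\<close> is strictly positive. Hence \<open>D\<^sub>\<alpha>\<close>
  becomes strictly diagonally dominant when its columns are scaled by \<open>u1 > 0\<close>, and is nonsingular
  (\<open>det_nonzero_Z_matrix_positive_vec\<close>, \<open>minv_shift\<close>).

  Row sums of \<open>Y\<^sub>k\<close>. The blocks \<open>Q\<^sub>i\<^sup>T W\<^sub>j\<close> of \<open>T\<^sub>k\<close> depend only on \<open>i + j\<close>; write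
  \<open>H\<^bsub>i+j\<^esub>\<close> for them. Induction on the doubling step shows that row block \<open>i\<close> of \<open>Y\<^sub>k\<close> sums to
  \<open>Y\<^sub>0 + \<gamma> (H\<^sub>0 + \<dots> + H\<^bsub>i-1\<^esub>)\<close> (\<open>Y_mult_constant\<close>).

  Telescoping. In such a row sum, \<open>Cr\<^sup>T u2\<close> is multiplied by \<open>Cl\<close>, and \<open>C u2 = D u1 - v1\<close>. The terms
  with \<open>v1\<close> are those of \<open>v1\<^sup>(\<^sup>k\<^sup>)\<close>. As \<open>D\<^sub>\<alpha>\<^sub>\<beta> = I - \<gamma> D\<^sub>\<alpha>\<^sup>-\<^sup>1 D\<close>, one has
  \<open>\<gamma> Q\<^sub>t\<^sup>T D\<^sub>\<alpha>\<^sup>-\<^sup>1 D u1 = Q\<^sub>t\<^sup>T u1 - Q\<^bsub>t+1\<^esub>\<^sup>T u1\<close>, so the terms with \<open>D u1\<close> that carry a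
  factor \<open>\<gamma>\<close> collapse to \<open>Q\<^sub>0\<^sup>T u1 - Q\<^sub>i\<^sup>T u1\<close>. The one from \<open>Y\<^sub>0\<close> is
  \<open>\<alpha> Q\<^sub>0\<^sup>T D u1 = Br\<^sup>T u1 - Q\<^sub>0\<^sup>T u1\<close>, and together they leave \<open>Q\<^sub>i\<^sup>T u1\<close> of \<open>Br\<^sup>T u1\<close> (\<open>doubling_identity\<close>).

  The last two equations of the theorem come from the first by eliminating one of the two unknown
  block vectors between the two halves (\<open>eliminate_coupled_blocks\<close>).
\<close>

section \<open>Inverting a diagonally dominant Z-matrix\<close>

lemma minv_inverse:
  assumes "M \<in> carrier_mat n n" "det M \<noteq> 0"
  shows "M * minv M = 1\<^sub>m n" "minv M * M = 1\<^sub>m n" "minv M \<in> carrier_mat n n"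
proof -
  have "mat_inverse M \<noteq> None"
    using mat_inverse(1)[OF assms(1), of "()"] det_non_zero_imp_unit[OF assms, of "()"] by blast
  then obtain N where "mat_inverse M = Some N" by auto
  with mat_inverse(2)[OF assms(1) this]
  show "M * minv M = 1\<^sub>m n" "minv M * M = 1\<^sub>m n" "minv M \<in> carrier_mat n n"
    by (auto simp: minv_def)
qed

text \<open>Diagonal dominance with weights \<open>u\<close>: for a kernel vector \<open>x\<close>, look at the row \<open>i\<close> where
  \<open>|x\<^sub>i| / u\<^sub>i\<close> attains its maximum \<open>r\<close>. Bounding the other entries by \<open>r u\<^sub>l\<close> in
  \<open>(M x)\<^sub>i = 0\<close> gives \<open>r (M u)\<^sub>i \<le> 0\<close>, which forces \<open>x = 0\<close>.\<close>

lemma det_nonzero_Z_matrix_positive_vec: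
  fixes M :: "real mat"
  assumes M: "M \<in> carrier_mat n n"
    and offdiag: "\<And>i j. i < n \<Longrightarrow> j < n \<Longrightarrow> i \<noteq> j \<Longrightarrow> M $$ (i, j) \<le> 0"
    and u: "u \<in> carrier_vec n" "\<And>i. i < n \<Longrightarrow> 0 < u $ i"
    and Mu: "\<And>i. i < n \<Longrightarrow> 0 < (M *\<^sub>v u) $ i"
  shows "det M \<noteq> 0"
proof
  assume "det M = 0"
  then obtain x where x: "x \<in> carrier_vec n" "x \<noteq> 0\<^sub>v n" "M *\<^sub>v x = 0\<^sub>v n"
    using det_0_iff_vec_prod_zero[OF M] by auto
  obtain j where j: "j < n" "x $ j \<noteq> 0" using x(1,2) by (metis carrier_vecD eq_vecI index_zero_vec(1,2))
  let ?r = "\<lambda>i. \<bar>x $ i\<bar> / u $ i"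
  define r where "r = Max (?r ` {..<n})"
  have fin: "finite (?r ` {..<n})" "?r ` {..<n} \<noteq> {}" using j by auto
  obtain i where i: "i < n" "r = ?r i" using Max_in[OF fin] unfolding r_def by auto
  have le: "\<bar>x $ l\<bar> \<le> r * u $ l" if "l < n" for l
  proof -
    have "?r l \<le> r" unfolding r_def using fin that by (intro Max_ge) auto
    then show ?thesis using u(2)[OF that] by (simp add: pos_divide_le_eq)
  qed
  have eq: "\<bar>x $ i\<bar> = r * u $ i" using i u(2)[OF i(1)] by simp
  have "0 < \<bar>x $ j\<bar>" using j by simp
  also have "\<dots> \<le> r * u $ j" using le j by simp
  finally have r: "0 < r" using u(2)[OF j(1)] by (simp add: zero_less_mult_iff)
  let ?N = "{..<n} - {i}"
  have row: "(M *\<^sub>v y) $ i = M $$ (i, i) * y $ i + (\<Sum>l\<in>?N. M $$ (i, l) * y $ l)"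
    if "y \<in> carrier_vec n" for y
  proof -
    have "(M *\<^sub>v y) $ i = (\<Sum>l\<in>{..<n}. M $$ (i, l) * y $ l)"
      using M i that by (auto simp: scalar_prod_def atLeast0LessThan intro!: sum.cong)
    then show ?thesis using i by (simp add: sum.remove)
  qed
  have "M $$ (i, i) * \<bar>x $ i\<bar> \<le> \<bar>M $$ (i, i) * x $ i\<bar>" by (simp add: abs_mult mult_right_mono)
  also have "\<dots> = \<bar>\<Sum>l\<in>?N. M $$ (i, l) * x $ l\<bar>"
    using row[OF x(1)] x(3) i by auto
  also have "\<dots> \<le> (\<Sum>l\<in>?N. \<bar>M $$ (i, l) * x $ l\<bar>)" by (rule sum_abs)
  also have "\<dots> \<le> (\<Sum>l\<in>?N. - M $$ (i, l) * (r * u $ l))"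
  proof (rule sum_mono)
    fix l assume l: "l \<in> ?N"
    then have "\<bar>M $$ (i, l) * x $ l\<bar> = - M $$ (i, l) * \<bar>x $ l\<bar>"
      using offdiag[of i l] i by (auto simp: abs_mult)
    also have "\<dots> \<le> - M $$ (i, l) * (r * u $ l)"
      using le[of l] offdiag[of i l] l i by (intro mult_left_mono) auto
    finally show "\<bar>M $$ (i, l) * x $ l\<bar> \<le> - M $$ (i, l) * (r * u $ l)" .
  qed
  also have "\<dots> = - (r * (\<Sum>l\<in>?N. M $$ (i, l) * u $ l))"
    by (simp add: sum_distrib_left sum_negf ac_simps)
  finally have "r * (M *\<^sub>v u) $ i \<le> 0"
    unfolding row[OF u(1)] eq by (simp add: algebra_simps)
  with r Mu[OF i(1)] show False by (simp add: mult_le_0_iff)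
qed

lemma M_matrix_offdiag_nonpos:
  assumes "M_matrix n M" "i < n" "j < n" "i \<noteq> j"
  shows "M $$ (i, j) \<le> 0"
proof -
  obtain s N where N: "N \<in> carrier_mat n n" "0\<^sub>m n n \<le> N" "M = s \<cdot>\<^sub>m 1\<^sub>m n - N"
    using assms(1) by (auto simp: M_matrix_def M_matrix_repr_def)
  have "0 \<le> N $$ (i, j)" using N(1,2) assms(2,3) by (auto simp: less_eq_mat_def)
  then show ?thesis using N assms(2-4) by simp
qed

lemma smult_mult_mat_vec:
  fixes M :: "real mat"
  assumes "M \<in> carrier_mat a b" "x \<in> carrier_vec b"
  shows "(c \<cdot>\<^sub>m M) *\<^sub>v x = c \<cdot>\<^sub>v (M *\<^sub>v x)"
  using assms by (intro eq_vecI) (auto simp: scalar_prod_def sum_distrib_left ac_simps)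

lemma zero_mat_mult_vec:
  "v \<in> carrier_vec b \<Longrightarrow> 0\<^sub>m a b *\<^sub>v v = (0\<^sub>v a :: real vec)"
  by (intro eq_vecI) auto

lemma nonneg_mat_mult_vec:
  fixes M :: "real mat"
  assumes "M \<in> carrier_mat a b" "0\<^sub>m a b \<le> M" "x \<in> carrier_vec b"
    and "\<And>j. j < b \<Longrightarrow> 0 \<le> x $ j" and "i < a"
  shows "0 \<le> (M *\<^sub>v x) $ i"
  using assms by (auto simp: less_eq_mat_def scalar_prod_def intro!: sum_nonneg)

lemma shift_mult_vec:
  assumes "M \<in> carrier_mat n n" "x \<in> carrier_vec n"
  shows "shift t M *\<^sub>v x = t \<cdot>\<^sub>v (M *\<^sub>v x) + x"
  using assms
  by (simp add: shift_def smult_mult_mat_vec[of _ n n] add_mult_distrib_mat_vec[of _ n n])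

text \<open>The dominance of \<open>t M + I\<close> comes from the identity: \<open>(t M + I) u = t (M u) + u \<ge> u > 0\<close>, also
  when \<open>M u\<close> has zero entries.\<close>

lemma minv_shift:
  assumes M: "M \<in> carrier_mat n n" and t: "0 \<le> t"
    and offdiag: "\<And>i j. i < n \<Longrightarrow> j < n \<Longrightarrow> i \<noteq> j \<Longrightarrow> M $$ (i, j) \<le> 0"
    and u: "u \<in> carrier_vec n" "\<And>i. i < n \<Longrightarrow> 0 < u $ i"
    and Mu: "\<And>i. i < n \<Longrightarrow> 0 \<le> (M *\<^sub>v u) $ i"
  shows "shift t M * minv (shift t M) = 1\<^sub>m n" "minv (shift t M) * shift t M = 1\<^sub>m n"
    "minv (shift t M) \<in> carrier_mat n n"
proof -
  have carr: "shift t M \<in> carrier_mat n n" using M by (simp add: shift_def)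
  have "det (shift t M) \<noteq> 0"
  proof (rule det_nonzero_Z_matrix_positive_vec[OF carr _ u])
    show "shift t M $$ (i, j) \<le> 0" if "i < n" "j < n" "i \<noteq> j" for i j
      using that M t offdiag[OF that] by (simp add: shift_def mult_nonneg_nonpos)
    show "0 < (shift t M *\<^sub>v u) $ i" if "i < n" for i
      unfolding shift_mult_vec[OF M u(1)] using that M t u Mu[OF that]
      by (simp add: add_nonneg_pos del: index_mult_mat_vec)
  qed
  from minv_inverse[OF carr this]
  show "shift t M * minv (shift t M) = 1\<^sub>m n" "minv (shift t M) * shift t M = 1\<^sub>m n"
    "minv (shift t M) \<in> carrier_mat n n" .
qed

section \<open>Stacked block vectors\<close>

text \<open>The family \<open>f\<close> stacked into one vector. The defining index arithmetic is that of the Kronecker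
  product and of the block rows, so all three can be compared entrywise.\<close>

definition block_vec :: "nat \<Rightarrow> nat \<Rightarrow> (nat \<Rightarrow> real vec) \<Rightarrow> real vec" where
  "block_vec l p f = vec (l * p) (\<lambda>i. f (i div p) $ (i mod p))"

lemma block_index:
  assumes "i < l * (p::nat)"
  shows "i div p < l" "i mod p < p"
proof -
  have "0 < p" using assms by (cases p) auto
  with assms show "i div p < l" "i mod p < p" by (auto simp: less_mult_imp_div_less)
qed

lemma block_vec_carrier [simp]: "block_vec l p f \<in> carrier_vec (l * p)"
  by (simp add: block_vec_def)

lemma dim_block_vec [simp]: "dim_vec (block_vec l p f) = l * p"
  by (simp add: block_vec_def)

lemma block_vec_cong:
  "(\<And>i. i < l \<Longrightarrow> f i = g i) \<Longrightarrow> block_vec l p f = block_vec l p g"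
  by (auto simp: block_vec_def block_index)

lemma block_vec_add:
  assumes "\<And>i. i < l \<Longrightarrow> g i \<in> carrier_vec p"
  shows "block_vec l p f + block_vec l p g = block_vec l p (\<lambda>i. f i + g i)"
proof (intro eq_vecI)
  fix i assume "i < dim_vec (block_vec l p (\<lambda>i. f i + g i))"
  then have i: "i < l * p" by simp
  show "(block_vec l p f + block_vec l p g) $ i = block_vec l p (\<lambda>i. f i + g i) $ i"
    using i block_index[OF i] assms[of "i div p"] by (simp add: block_vec_def)
qed simp

lemma block_vec_smult:
  assumes "\<And>i. i < l \<Longrightarrow> f i \<in> carrier_vec p"
  shows "c \<cdot>\<^sub>v block_vec l p f = block_vec l p (\<lambda>i. c \<cdot>\<^sub>v f i)"
proof (intro eq_vecI)
  fix i assume "i < dim_vec (block_vec l p (\<lambda>i. c \<cdot>\<^sub>v f i))"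
  then have i: "i < l * p" by simp
  show "(c \<cdot>\<^sub>v block_vec l p f) $ i = block_vec l p (\<lambda>i. c \<cdot>\<^sub>v f i) $ i"
    using i block_index[OF i] assms[of "i div p"] by (simp add: block_vec_def)
qed simp

lemma block_vec_append:
  "block_vec l p f @\<^sub>v block_vec l' p (\<lambda>i. f (l + i)) = block_vec (l + l') p f"
proof (intro eq_vecI)
  fix i assume "i < dim_vec (block_vec (l + l') p f)"
  then have i: "i < (l + l') * p" by simp
  then have p: "0 < p" by (cases p) auto
  show "(block_vec l p f @\<^sub>v block_vec l' p (\<lambda>i. f (l + i))) $ i = block_vec (l + l') p f $ i"
  proof (cases "i < l * p")
    case True
    then show ?thesis using i by (simp add: block_vec_def)
  next
    case False
    define r where "r = i - l * p"
    have ir: "i = r + l * p" using False by (simp add: r_def)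
    show ?thesis using i p unfolding ir by (simp add: block_vec_def algebra_simps)
  qed
qed (simp add: algebra_simps)

lemma ones_kron_eq_block_vec:
  "ones_vec l \<otimes>\<^sub>v x = block_vec l (dim_vec x) (\<lambda>_. x)"
  by (auto simp: block_vec_def kron_vec_def ones_vec_def block_index)

lemma transpose_block_row_mult:
  assumes F: "\<And>j. F j \<in> carrier_mat n p" and x: "x \<in> carrier_vec n"
  shows "transpose_mat (block_row F l) *\<^sub>v x = block_vec l p (\<lambda>j. transpose_mat (F j) *\<^sub>v x)"
proof (intro eq_vecI)
  fix i assume "i < dim_vec (block_vec l p (\<lambda>j. transpose_mat (F j) *\<^sub>v x))"
  then have i: "i < l * p" by simp
  have d: "dim_row (F j) = n" "dim_col (F j) = p" for j using F[of j] by auto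
  show "(transpose_mat (block_row F l) *\<^sub>v x) $ i
      = block_vec l p (\<lambda>j. transpose_mat (F j) *\<^sub>v x) $ i"
    using i block_index[OF i] x d
    by (auto simp: block_vec_def block_row_def Let_def scalar_prod_def intro!: sum.cong)
qed (use F[of 0] in \<open>auto simp: block_row_def Let_def\<close>)

lemma partial_sum_carrier:
  assumes F: "\<And>j. F j \<in> carrier_mat n q"
  shows "partial_sum F l \<in> carrier_mat n q"
proof (induction l)
  case 0
  show ?case using F[of 0] by simp
next
  case (Suc l)
  then show ?case using F[of l] by simp
qed

lemma partial_sum_index:
  assumes F: "\<And>j. F j \<in> carrier_mat n q" and "i < n" "j < q"
  shows "partial_sum F l $$ (i, j) = (\<Sum>t<l. F t $$ (i, j))"
proof (induction l)
  case 0
  then show ?case using F[of 0] assms(2,3) by auto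
next
  case (Suc l)
  then show ?case using F[of l] partial_sum_carrier[of F n q l, OF F] assms(2,3) by (simp add: index_add_mat)
qed

lemma sum_blocks:
  fixes f :: "nat \<Rightarrow> nat \<Rightarrow> real"
  shows "(\<Sum>i<l * q. f (i div q) (i mod q)) = (\<Sum>t<l. \<Sum>r<q. f t r)"
proof -
  have "(\<Sum>i<l * q. f (i div q) (i mod q))
      = (\<Sum>t<l. \<Sum>i\<in>{t * q..<t * q + q}. f (i div q) (i mod q))"
    by (rule sum.nat_group[symmetric])
  also have "\<dots> = (\<Sum>t<l. \<Sum>r<q. f t r)"
  proof (rule sum.cong[OF refl])
    fix t
    have "(\<Sum>i\<in>{t * q..<t * q + q}. f (i div q) (i mod q))
        = (\<Sum>r<q. f ((t * q + r) div q) ((t * q + r) mod q))"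
      by (subst sum.atLeastLessThan_shift_0) (simp add: atLeast0LessThan)
    also have "\<dots> = (\<Sum>r<q. f t r)" by (intro sum.cong) auto
    finally show "(\<Sum>i\<in>{t * q..<t * q + q}. f (i div q) (i mod q)) = (\<Sum>r<q. f t r)" .
  qed
  finally show ?thesis .
qed

text \<open>Stated with \<open>partial_sum\<close> so that products with \<open>T\<^sub>k\<close> become
  differences of partial sums.\<close>

lemma block_row_mult_constant:
  assumes F: "\<And>j. F j \<in> carrier_mat n q" and x: "x \<in> carrier_vec q"
  shows "block_row F l *\<^sub>v block_vec l q (\<lambda>_. x) = partial_sum F l *\<^sub>v x"
proof (intro eq_vecI)
  have d: "dim_row (F j) = n" "dim_col (F j) = q" for j using F[of j] by auto
  note ps = partial_sum_carrier[of F n q l, OF F]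
  fix i assume "i < dim_vec (partial_sum F l *\<^sub>v x)"
  then have i: "i < n" using ps by simp
  have "(block_row F l *\<^sub>v block_vec l q (\<lambda>_. x)) $ i
      = (\<Sum>k<l * q. F (k div q) $$ (i, k mod q) * x $ (k mod q))"
    using i d by (auto simp: block_vec_def block_row_def Let_def scalar_prod_def atLeast0LessThan
        intro!: sum.cong)
  also have "\<dots> = (\<Sum>t<l. \<Sum>r<q. F t $$ (i, r) * x $ r)"
    by (rule sum_blocks)
  also have "\<dots> = (\<Sum>r<q. (\<Sum>t<l. F t $$ (i, r)) * x $ r)"
    unfolding sum_distrib_right by (rule sum.swap)
  also have "\<dots> = (partial_sum F l *\<^sub>v x) $ i"
    using i x ps partial_sum_index[of F n q, OF F i]
    by (auto simp: scalar_prod_def atLeast0LessThan intro!: sum.cong)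
  finally show "(block_row F l *\<^sub>v block_vec l q (\<lambda>_. x)) $ i = (partial_sum F l *\<^sub>v x) $ i" .
qed (use F[of 0] partial_sum_carrier[of F n q l, OF F] in \<open>auto simp: block_row_def Let_def\<close>)

section \<open>The doubling recursion as a Hankel matrix\<close>

text \<open>The locale describes one half of the data, so that the two halves of the theorem are two
  interpretations: \<open>(Q, W, T, Y)\<close> driven by \<open>D\<^sub>\<alpha>\<^sub>\<beta>\<close>, and \<open>(V, U, S, Z)\<close> driven by \<open>A\<^sub>\<alpha>\<^sub>\<beta>\<close> with
  the roles of \<open>p\<close> and \<open>q\<close> exchanged.\<close>

locale doubling =
  fixes n p q :: nat and G :: "real mat" and Q W T Y :: "nat \<Rightarrow> real mat" and \<gamma> :: real
  assumes G: "G \<in> carrier_mat n n"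
    and Q0: "Q 0 \<in> carrier_mat n p" and Q_Suc: "\<And>j. Q (Suc j) = transpose_mat G * Q j"
    and W0: "W 0 \<in> carrier_mat n q" and W_Suc: "\<And>j. W (Suc j) = G * W j"
    and T: "\<And>j. T j = transpose_mat (block_row Q (2 ^ j)) * block_row W (2 ^ j)"
    and Y0: "Y 0 \<in> carrier_mat p q"
    and Y_Suc: "\<And>j. Y (Suc j) =
      four_block_mat (0\<^sub>m (2 ^ j * p) (2 ^ j * q)) (Y j) (Y j) (\<gamma> \<cdot>\<^sub>m T j)"
begin

lemma Q_carrier: "Q j \<in> carrier_mat n p"
  using G Q0 by (induction j) (auto simp: Q_Suc)

lemma W_carrier: "W j \<in> carrier_mat n q"
  using G W0 by (induction j) (auto simp: W_Suc)

lemmas partial_sum_Q_carrier = partial_sum_carrier[of Q n p, OF Q_carrier]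
lemmas partial_sum_W_carrier = partial_sum_carrier[of W n q, OF W_carrier]

lemma block_row_carrier:
  "block_row Q l \<in> carrier_mat n (l * p)" "block_row W l \<in> carrier_mat n (l * q)"
  using Q0 W0 by (auto simp: block_row_def Let_def)

lemma Y_carrier: "Y k \<in> carrier_mat (2 ^ k * p) (2 ^ k * q)"
proof (induction k)
  case (Suc k)
  have "T k \<in> carrier_mat (2 ^ k * p) (2 ^ k * q)"
    using block_row_carrier[of "2 ^ k"] by (auto simp: T)
  with Suc show ?case by (auto simp: Y_Suc)
qed (simp add: Y0)

lemma transpose_Q_Suc: "transpose_mat (Q (Suc j)) = transpose_mat (Q j) * G"
  using transpose_mult[of "transpose_mat G" n n "Q j" p] G Q_carrier[of j] by (simp add: Q_Suc)

text \<open>Powers of \<open>G\<close> can be moved from the left factor to the right one, so the blocks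
  \<open>Q\<^sub>i\<^sup>T W\<^sub>j\<close> of \<open>T\<^sub>k\<close> depend on \<open>i + j\<close> only: \<open>T\<^sub>k\<close> is block Hankel.\<close>

lemma transpose_Q_mult_W: "transpose_mat (Q (i + j)) * W 0 = transpose_mat (Q i) * W j"
proof (induction j arbitrary: i)
  case (Suc j)
  have "transpose_mat (Q (i + Suc j)) * W 0 = transpose_mat (Q (Suc i)) * W j"
    using Suc.IH[of "Suc i"] by simp
  also have "\<dots> = transpose_mat (Q i) * W (Suc j)"
    unfolding transpose_Q_Suc W_Suc
    using Q_carrier[of i] by (intro assoc_mult_mat[OF _ G W_carrier]) auto
  finally show ?case .
qed simp

text \<open>By the Hankel structure, row block \<open>i\<close> of \<open>T\<close> summed over the first \<open>l\<close> columns is the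
  window \<open>H\<^sub>i + \<dots> + H\<^bsub>i+l-1\<^esub>\<close> of the sequence \<open>H\<^sub>t = Q\<^sub>t\<^sup>T W\<^sub>0\<close>, that is, a difference of two
  prefix sums. This is what makes the row sums of consecutive \<open>Y\<^sub>k\<close> fit together.\<close>

lemma partial_sum_Q_add:
  assumes x: "x \<in> carrier_vec q"
  shows "transpose_mat (partial_sum Q (i + l)) *\<^sub>v (W 0 *\<^sub>v x)
    = transpose_mat (partial_sum Q i) *\<^sub>v (W 0 *\<^sub>v x)
      + transpose_mat (Q i) *\<^sub>v (partial_sum W l *\<^sub>v x)"
proof (induction l)
  case 0
  have "partial_sum W 0 *\<^sub>v x = 0\<^sub>v n" using W0 x by auto
  then show ?case using Q_carrier[of i] partial_sum_Q_carrier[of i] by auto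
next
  case (Suc l)
  let ?y = "W 0 *\<^sub>v x" and ?t = transpose_mat
  have y: "?y \<in> carrier_vec n" using W0 x by auto
  have Qt: "?t (Q j) \<in> carrier_mat p n" "?t (partial_sum Q j) \<in> carrier_mat p n" for j
    using Q_carrier[of j] partial_sum_Q_carrier[of j] by auto
  have Wx: "W l *\<^sub>v x \<in> carrier_vec n" "partial_sum W l *\<^sub>v x \<in> carrier_vec n"
    using W_carrier[of l] partial_sum_W_carrier[of l] x by auto
  have "?t (Q (i + l)) *\<^sub>v ?y = (?t (Q (i + l)) * W 0) *\<^sub>v x"
    using Qt W0 x by (intro assoc_mult_mat_vec[symmetric])
  also have "\<dots> = ?t (Q i) *\<^sub>v (W l *\<^sub>v x)"
    unfolding transpose_Q_mult_W using Qt W_carrier x by (intro assoc_mult_mat_vec)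
  finally have step: "?t (Q (i + l)) *\<^sub>v ?y = ?t (Q i) *\<^sub>v (W l *\<^sub>v x)" .
  have "?t (partial_sum Q (i + Suc l)) *\<^sub>v ?y
      = ?t (partial_sum Q (i + l)) *\<^sub>v ?y + ?t (Q (i + l)) *\<^sub>v ?y"
    using transpose_add[OF partial_sum_Q_carrier Q_carrier]
      add_mult_distrib_mat_vec[OF Qt(2) Qt(1) y] by simp
  also have "\<dots> = ?t (partial_sum Q i) *\<^sub>v ?y
      + (?t (Q i) *\<^sub>v (partial_sum W l *\<^sub>v x) + ?t (Q i) *\<^sub>v (W l *\<^sub>v x))"
    unfolding Suc.IH step
    by (intro assoc_add_vec[of _ p] mult_mat_vec_carrier[OF Qt(1)] mult_mat_vec_carrier[OF Qt(2)] y Wx)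
  also have "\<dots> = ?t (partial_sum Q i) *\<^sub>v ?y
      + ?t (Q i) *\<^sub>v (partial_sum W (Suc l) *\<^sub>v x)"
    using mult_add_distrib_mat_vec[OF Qt(1) Wx(2) Wx(1)]
      add_mult_distrib_mat_vec[OF partial_sum_W_carrier W_carrier x] by simp
  finally show ?case .
qed

text \<open>Unfolded, \<open>Y\<^sub>k\<close> has zero blocks above its block antidiagonal, \<open>Y\<^sub>0\<close> on it and
  \<open>\<gamma> H\<^bsub>i+j-l\<^esub>\<close> (with \<open>l = 2\<^sup>k\<close>) below it, so its row block \<open>i\<close> sums to
  \<open>Y\<^sub>0 + \<gamma> (H\<^sub>0 + \<dots> + H\<^bsub>i-1\<^esub>)\<close>. In the induction the upper half of \<open>Y\<^bsub>k+1\<^esub>\<close> reproduces the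
  row sums of \<open>Y\<^sub>k\<close>, and in the lower half the contribution of \<open>T\<^sub>k\<close> extends the prefix sum of
  length \<open>i\<close> to length \<open>l + i\<close>.\<close>

lemma Y_mult_constant:
  assumes x: "x \<in> carrier_vec q"
  shows "Y k *\<^sub>v block_vec (2 ^ k) q (\<lambda>_. x)
    = block_vec (2 ^ k) p
        (\<lambda>i. Y 0 *\<^sub>v x + \<gamma> \<cdot>\<^sub>v (transpose_mat (partial_sum Q i) *\<^sub>v (W 0 *\<^sub>v x)))"
    (is "_ = block_vec _ _ ?h")
proof (induction k)
  case 0
  have "transpose_mat (partial_sum Q 0) *\<^sub>v (W 0 *\<^sub>v x) = 0\<^sub>v p"
    using Q0 W0 x by (simp add: zero_transpose_mat zero_mat_mult_vec)
  then have "?h 0 = Y 0 *\<^sub>v x" using Y0 x by auto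
  moreover have "block_vec 1 r (\<lambda>_. z) = z" if "z \<in> carrier_vec r" for r z
    using that by (auto simp: block_vec_def)
  moreover have "block_vec 1 p ?h = block_vec 1 p (\<lambda>_. ?h 0)" by (rule block_vec_cong) simp
  ultimately show ?case using Y0 x by simp
next
  case (Suc k)
  let ?l = "2 ^ k :: nat" and ?c = "block_vec (2 ^ k) q (\<lambda>_. x)" and ?t = transpose_mat
  have Tk: "T k \<in> carrier_mat (?l * p) (?l * q)"
    using block_row_carrier[of ?l] by (auto simp: T)
  have hc: "?h i \<in> carrier_vec p" for i
    using Y0 partial_sum_Q_carrier[of i] W0 x
    by (intro add_carrier_vec smult_carrier_vec mult_mat_vec_carrier[of _ p q]
        mult_mat_vec_carrier[of _ p n] mult_mat_vec_carrier[of _ n q]) auto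
  have psx: "partial_sum W ?l *\<^sub>v x \<in> carrier_vec n"
    using partial_sum_W_carrier[of ?l] x by auto
  have Qpsx: "?t (Q i) *\<^sub>v (partial_sum W ?l *\<^sub>v x) \<in> carrier_vec p" for i
    using Q_carrier[of i] psx by auto
  have "T k *\<^sub>v ?c = ?t (block_row Q ?l) *\<^sub>v (block_row W ?l *\<^sub>v ?c)"
    unfolding T using block_row_carrier[of ?l] by (intro assoc_mult_mat_vec) auto
  also have "\<dots> = block_vec ?l p (\<lambda>i. ?t (Q i) *\<^sub>v (partial_sum W ?l *\<^sub>v x))"
    unfolding block_row_mult_constant[OF W_carrier x]
    by (rule transpose_block_row_mult[OF Q_carrier psx])
  finally have "Y k *\<^sub>v ?c + (\<gamma> \<cdot>\<^sub>m T k) *\<^sub>v ?c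
      = block_vec ?l p (\<lambda>i. ?h i + \<gamma> \<cdot>\<^sub>v (?t (Q i) *\<^sub>v (partial_sum W ?l *\<^sub>v x)))"
    using Qpsx by (simp add: smult_mult_mat_vec[OF Tk] Suc.IH block_vec_smult block_vec_add)
  also have "\<dots> = block_vec ?l p (\<lambda>i. ?h (?l + i))"
  proof (rule block_vec_cong)
    fix i
    have c: "Y 0 *\<^sub>v x \<in> carrier_vec p"
      "?t (partial_sum Q i) *\<^sub>v (W 0 *\<^sub>v x) \<in> carrier_vec p"
      "?t (Q i) *\<^sub>v (partial_sum W ?l *\<^sub>v x) \<in> carrier_vec p"
      using Y0 W0 x psx partial_sum_Q_carrier[of i] Q_carrier[of i] by auto
    show "?h i + \<gamma> \<cdot>\<^sub>v (?t (Q i) *\<^sub>v (partial_sum W ?l *\<^sub>v x)) = ?h (?l + i)"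
      using c by (simp add: partial_sum_Q_add[OF x, of i ?l] add.commute[of ?l i]
          smult_add_distrib_vec[of _ p] assoc_add_vec[of _ p])
  qed
  finally have lower: "Y k *\<^sub>v ?c + (\<gamma> \<cdot>\<^sub>m T k) *\<^sub>v ?c = block_vec ?l p (\<lambda>i. ?h (?l + i))" .
  have upper: "0\<^sub>m (?l * p) (?l * q) *\<^sub>v ?c + Y k *\<^sub>v ?c = block_vec ?l p ?h"
    unfolding Suc.IH by (auto simp: zero_mat_mult_vec)
  have "Y (Suc k) *\<^sub>v block_vec (2 ^ Suc k) q (\<lambda>_. x) = Y (Suc k) *\<^sub>v (?c @\<^sub>v ?c)"
    using block_vec_append[of ?l q "\<lambda>_. x" ?l] by (simp add: mult_2)
  also have "\<dots> = block_vec ?l p ?h @\<^sub>v block_vec ?l p (\<lambda>i. ?h (?l + i))"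
    unfolding Y_Suc using Tk Y_carrier[of k]
    by (subst four_block_mat_mult_vec[of _ "?l * p" "?l * q" _ "?l * q" _ "?l * p"])
      (auto simp: upper lower)
  also have "\<dots> = block_vec (2 ^ Suc k) p ?h"
    using block_vec_append[of ?l p ?h ?l] by (simp add: mult_2)
  finally show ?case .
qed

text \<open>Applying \<open>Q\<^sub>i\<^sup>T\<close> to \<open>G u = u - \<gamma> w\<close> gives
  \<open>Q\<^bsub>i+1\<^esub>\<^sup>T u = Q\<^sub>i\<^sup>T u - \<gamma> Q\<^sub>i\<^sup>T w\<close>, and these steps add up.\<close>

lemma transpose_Q_telescope:
  assumes u: "u \<in> carrier_vec n" and w: "w \<in> carrier_vec n" and Gu: "G *\<^sub>v u + \<gamma> \<cdot>\<^sub>v w = u"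
  shows "transpose_mat (Q i) *\<^sub>v u + \<gamma> \<cdot>\<^sub>v (transpose_mat (partial_sum Q i) *\<^sub>v w)
    = transpose_mat (Q 0) *\<^sub>v u"
proof (induction i)
  case 0
  have "transpose_mat (partial_sum Q 0) *\<^sub>v w = 0\<^sub>v p"
    using Q0 w by (simp add: zero_transpose_mat zero_mat_mult_vec)
  then show ?case using Q0 by auto
next
  case (Suc i)
  let ?t = transpose_mat
  have Qt: "?t (Q i) \<in> carrier_mat p n" "?t (partial_sum Q i) \<in> carrier_mat p n"
    using Q_carrier[of i] partial_sum_Q_carrier[of i] by auto
  have Gu_carrier: "G *\<^sub>v u \<in> carrier_vec n" using G u by auto
  have ps: "?t (partial_sum Q (Suc i)) *\<^sub>v w = ?t (partial_sum Q i) *\<^sub>v w + ?t (Q i) *\<^sub>v w"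
    using transpose_add[OF partial_sum_Q_carrier Q_carrier, of i i]
      add_mult_distrib_mat_vec[OF Qt(2,1) w] by simp
  have "?t (Q i) *\<^sub>v u = ?t (Q i) *\<^sub>v (G *\<^sub>v u + \<gamma> \<cdot>\<^sub>v w)" by (simp add: Gu)
  also have "\<dots> = ?t (Q (Suc i)) *\<^sub>v u + \<gamma> \<cdot>\<^sub>v (?t (Q i) *\<^sub>v w)"
    unfolding transpose_Q_Suc using Qt(1) G u w Gu_carrier
    by (simp add: mult_add_distrib_mat_vec[of _ p n] mult_mat_vec[of _ p n])
  finally have "?t (Q i) *\<^sub>v u = ?t (Q (Suc i)) *\<^sub>v u + \<gamma> \<cdot>\<^sub>v (?t (Q i) *\<^sub>v w)" .
  with Suc.IH show ?case
    unfolding ps using Qt Q_carrier[of "Suc i"] Q0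
    by (auto simp: algebra_simps vec_eq_iff simp del: index_mult_mat_vec partial_sum.simps)
qed

text \<open>One block row of the system. Here \<open>E\<close> is the inverse of \<open>\<alpha> D + I\<close>. The products of \<open>Y\<^sub>k\<close>
  with \<open>x\<close> enter only through \<open>Cl x = D u - v\<close>. The part with \<open>v\<close> cancels against the \<open>v\<close>-terms
  of \<open>v'\<close>, and the part with \<open>D u\<close> telescopes: since \<open>G = E (I - \<beta> D)\<close> and \<open>\<gamma> = \<alpha> + \<beta>\<close>, one has
  \<open>G u = u - \<gamma> E D u\<close>. What is left is \<open>Q\<^sub>0\<^sup>T (\<alpha> D u + u) = Br\<^sup>T E (\<alpha> D + I) u = Br\<^sup>T u\<close>.\<close>

lemma doubling_identity:
  assumes D: "D \<in> carrier_mat n n" and E: "E \<in> carrier_mat n n"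
    and inv: "E * shift \<alpha> D = 1\<^sub>m n"
    and G_eq: "G = E * shift (- \<beta>) D" and \<gamma>: "\<gamma> = \<alpha> + \<beta>"
    and Br: "Br \<in> carrier_mat n p" and Cl: "Cl \<in> carrier_mat n q"
    and Q0_eq: "Q 0 = transpose_mat E * Br" and W0_eq: "W 0 = E * Cl"
    and Y0_eq: "Y 0 = \<alpha> \<cdot>\<^sub>m (transpose_mat Br * E * Cl)"
    and u: "u \<in> carrier_vec n" and v: "v \<in> carrier_vec n" and x: "x \<in> carrier_vec q"
    and Du: "D *\<^sub>v u = v + Cl *\<^sub>v x"
    and v': "v' = \<alpha> \<cdot>\<^sub>v (ones_vec (2 ^ k) \<otimes>\<^sub>v (transpose_mat (Q 0) *\<^sub>v v))
        + transpose_mat (block_row Q (2 ^ k)) *\<^sub>v u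
        + \<gamma> \<cdot>\<^sub>v (transpose_mat (block_row (partial_sum Q) (2 ^ k)) *\<^sub>v (E *\<^sub>v v))"
  shows "v' + Y k *\<^sub>v (ones_vec (2 ^ k) \<otimes>\<^sub>v x)
    = ones_vec (2 ^ k) \<otimes>\<^sub>v (transpose_mat Br *\<^sub>v u)"
proof -
  let ?t = transpose_mat
  let ?d = "Cl *\<^sub>v x" and ?l = "2 ^ k :: nat"
  have d: "?d \<in> carrier_vec n" and Ed: "E *\<^sub>v ?d \<in> carrier_vec n" and Ev: "E *\<^sub>v v \<in> carrier_vec n"
    and Du_carrier: "D *\<^sub>v u \<in> carrier_vec n" and EDu: "E *\<^sub>v (D *\<^sub>v u) \<in> carrier_vec n"
    and Eu: "E *\<^sub>v u \<in> carrier_vec n"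
    using Cl x E D u v by auto
  have sh: "shift t D \<in> carrier_mat n n" for t using D by (simp add: shift_def)
  have Qt0: "?t (Q 0) = ?t Br * E"
    using transpose_mult[of "?t E" n n Br p] E Br by (simp add: Q0_eq)
  have E_sh: "(E * shift t D) *\<^sub>v u = t \<cdot>\<^sub>v (E *\<^sub>v (D *\<^sub>v u)) + E *\<^sub>v u" for t
    using assoc_mult_mat_vec[OF E sh u] E Du_carrier u
    by (simp add: shift_mult_vec[OF D u] mult_add_distrib_mat_vec[of _ n n] mult_mat_vec[of _ n n])
  have u_eq: "\<alpha> \<cdot>\<^sub>v (E *\<^sub>v (D *\<^sub>v u)) + E *\<^sub>v u = u"
    using E_sh[of \<alpha>] u by (simp add: inv)
  have "G *\<^sub>v u + \<gamma> \<cdot>\<^sub>v (E *\<^sub>v (D *\<^sub>v u)) = \<alpha> \<cdot>\<^sub>v (E *\<^sub>v (D *\<^sub>v u)) + E *\<^sub>v u"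
    unfolding G_eq E_sh \<gamma> using EDu Eu
    by (auto simp: algebra_simps vec_eq_iff simp del: index_mult_mat_vec)
  then have Gu: "G *\<^sub>v u + \<gamma> \<cdot>\<^sub>v (E *\<^sub>v (D *\<^sub>v u)) = u" using u_eq by simp
  have Qt0_mult: "?t (Q 0) *\<^sub>v y = ?t Br *\<^sub>v (E *\<^sub>v y)" if "y \<in> carrier_vec n" for y
    unfolding Qt0 using Br E that by (intro assoc_mult_mat_vec) auto
  have W0x: "W 0 *\<^sub>v x = E *\<^sub>v ?d"
    unfolding W0_eq by (rule assoc_mult_mat_vec[OF E Cl x])
  have Y0x: "Y 0 *\<^sub>v x = \<alpha> \<cdot>\<^sub>v (?t (Q 0) *\<^sub>v ?d)"
  proof -
    have "?t Br * E * Cl \<in> carrier_mat p q" "?t Br * E \<in> carrier_mat p n" using Br E Cl by auto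
    then show ?thesis
      unfolding Y0_eq Qt0 using assoc_mult_mat_vec[OF _ Cl x] by (simp add: smult_mult_mat_vec[OF _ x])
  qed
  have row: "\<alpha> \<cdot>\<^sub>v (?t (Q 0) *\<^sub>v v) + ?t (Q i) *\<^sub>v u + \<gamma> \<cdot>\<^sub>v (?t (partial_sum Q i) *\<^sub>v (E *\<^sub>v v))
      + (Y 0 *\<^sub>v x + \<gamma> \<cdot>\<^sub>v (?t (partial_sum Q i) *\<^sub>v (W 0 *\<^sub>v x))) = ?t Br *\<^sub>v u" (is "?lhs = _") for i
  proof -
    let ?P = "?t (partial_sum Q i)"
    have P: "?P \<in> carrier_mat p n" and Qi: "?t (Q i) \<in> carrier_mat p n"
      and Q0': "?t (Q 0) \<in> carrier_mat p n" and Brt: "?t Br \<in> carrier_mat p n"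
      using partial_sum_Q_carrier[of i] Q_carrier[of i] Q0 Br by auto
    have e1: "?t (Q 0) *\<^sub>v (D *\<^sub>v u) = ?t (Q 0) *\<^sub>v v + ?t (Q 0) *\<^sub>v ?d"
      unfolding Du by (rule mult_add_distrib_mat_vec[OF Q0' v d])
    have e2: "?P *\<^sub>v (E *\<^sub>v (D *\<^sub>v u)) = ?P *\<^sub>v (E *\<^sub>v v) + ?P *\<^sub>v (E *\<^sub>v ?d)"
      unfolding Du mult_add_distrib_mat_vec[OF E v d] by (rule mult_add_distrib_mat_vec[OF P Ev Ed])
    have "?lhs = \<alpha> \<cdot>\<^sub>v (?t (Q 0) *\<^sub>v (D *\<^sub>v u))
        + (?t (Q i) *\<^sub>v u + \<gamma> \<cdot>\<^sub>v (?P *\<^sub>v (E *\<^sub>v (D *\<^sub>v u))))"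
      unfolding e1 e2 W0x Y0x using P Qi Q0'
      by (auto simp: algebra_simps vec_eq_iff simp del: index_mult_mat_vec)
    also have "\<dots> = \<alpha> \<cdot>\<^sub>v (?t (Q 0) *\<^sub>v (D *\<^sub>v u)) + ?t (Q 0) *\<^sub>v u"
      by (simp add: transpose_Q_telescope[OF u EDu Gu])
    also have "\<dots> = ?t Br *\<^sub>v (\<alpha> \<cdot>\<^sub>v (E *\<^sub>v (D *\<^sub>v u)) + E *\<^sub>v u)"
      unfolding Qt0_mult[OF u] Qt0_mult[OF Du_carrier] using Brt EDu Eu
      by (simp add: mult_add_distrib_mat_vec[of _ p n] mult_mat_vec[of _ p n])
    finally show ?thesis unfolding u_eq .
  qed
  have c: "?t (Q i) *\<^sub>v y \<in> carrier_vec p" "?t (partial_sum Q i) *\<^sub>v y \<in> carrier_vec p"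
    "Y 0 *\<^sub>v x \<in> carrier_vec p" if "y \<in> carrier_vec n" for i y
    using partial_sum_Q_carrier[of i] Q_carrier[of i] Y0 x that by auto
  have W0x_carrier: "W 0 *\<^sub>v x \<in> carrier_vec n" using W0 x by auto
  have dims: "dim_vec x = q" "dim_row (?t (Q 0)) = p" "dim_row (?t Br) = p" using x Q0 Br by auto
  show ?thesis
    unfolding v' ones_kron_eq_block_vec dim_mult_mat_vec dims Y_mult_constant[OF x]
      transpose_block_row_mult[OF Q_carrier u] transpose_block_row_mult[OF partial_sum_Q_carrier Ev]
    by (simp add: block_vec_smult block_vec_add c[OF v] c[OF u] c[OF Ev] c[OF W0x_carrier] c(3)[OF v] row del: index_mult_mat_vec)
qed

end

section \<open>Combining the two halves\<close>

text \<open>Eliminating \<open>x\<close> from the coupled equations \<open>y - Y x = v\<close> and \<open>x - Z y = w\<close>.\<close>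

lemma eliminate_block:
  fixes Y Z :: "real mat"
  assumes Y: "Y \<in> carrier_mat a b" and Z: "Z \<in> carrier_mat b a"
    and x: "x \<in> carrier_vec b" and y: "y \<in> carrier_vec a"
    and v: "v \<in> carrier_vec a" and w: "w \<in> carrier_vec b"
    and eqY: "v + Y *\<^sub>v x = y" and eqZ: "w + Z *\<^sub>v y = x"
  shows "(1\<^sub>m a - Y * Z) *\<^sub>v y = v + Y *\<^sub>v w"
proof -
  have Zy: "Z *\<^sub>v y \<in> carrier_vec b" and Yw: "Y *\<^sub>v w \<in> carrier_vec a"
    and YZy: "Y *\<^sub>v (Z *\<^sub>v y) \<in> carrier_vec a"
    using Y Z y w by auto
  have "(1\<^sub>m a - Y * Z) *\<^sub>v y = y - Y *\<^sub>v (Z *\<^sub>v y)"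
    using Y Z y by (simp add: minus_mult_distrib_mat_vec[of _ a a] assoc_mult_mat_vec[OF Y Z y])
  also have "\<dots> = v + Y *\<^sub>v (w + Z *\<^sub>v y) - Y *\<^sub>v (Z *\<^sub>v y)"
    by (simp add: eqY eqZ)
  also have "\<dots> = v + Y *\<^sub>v w"
    unfolding mult_add_distrib_mat_vec[OF Y w Zy] using v Yw YZy
    by (auto simp: vec_eq_iff simp del: index_mult_mat_vec)
  finally show ?thesis .
qed

lemma eliminate_coupled_blocks:
  fixes Y Z :: "real mat"
  assumes Y: "Y \<in> carrier_mat a b" and Z: "Z \<in> carrier_mat b a"
    and x: "x \<in> carrier_vec b" and y: "y \<in> carrier_vec a"
    and v: "v \<in> carrier_vec a" and w: "w \<in> carrier_vec b"
    and eqY: "v + Y *\<^sub>v x = y" and eqZ: "w + Z *\<^sub>v y = x"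
  shows "four_block_mat (- Y) (1\<^sub>m a) (1\<^sub>m b) (- Z) *\<^sub>v (x @\<^sub>v y) = v @\<^sub>v w"
    "(1\<^sub>m a - Y * Z) *\<^sub>v y = v + Y *\<^sub>v w"
    "(1\<^sub>m b - Z * Y) *\<^sub>v x = w + Z *\<^sub>v v"
proof -
  have "four_block_mat (- Y) (1\<^sub>m a) (1\<^sub>m b) (- Z) *\<^sub>v (x @\<^sub>v y)
      = ((- Y) *\<^sub>v x + 1\<^sub>m a *\<^sub>v y) @\<^sub>v (1\<^sub>m b *\<^sub>v x + (- Z) *\<^sub>v y)"
    using Y Z x y by (intro four_block_mat_mult_vec[of _ a b _ a _ b]) auto
  also have "(- Y) *\<^sub>v x + 1\<^sub>m a *\<^sub>v y = v"
  proof -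
    have "(- Y) *\<^sub>v x + 1\<^sub>m a *\<^sub>v y = - (Y *\<^sub>v x) + (v + Y *\<^sub>v x)"
      using Y x y by (simp add: eqY)
    then show ?thesis using v Y x by (auto simp: vec_eq_iff simp del: index_mult_mat_vec)
  qed
  also have "1\<^sub>m b *\<^sub>v x + (- Z) *\<^sub>v y = w"
  proof -
    have "1\<^sub>m b *\<^sub>v x + (- Z) *\<^sub>v y = (w + Z *\<^sub>v y) + - (Z *\<^sub>v y)"
      using Z x y by (simp add: eqZ)
    then show ?thesis using w Z y by (auto simp: vec_eq_iff simp del: index_mult_mat_vec)
  qed
  finally show "four_block_mat (- Y) (1\<^sub>m a) (1\<^sub>m b) (- Z) *\<^sub>v (x @\<^sub>v y) = v @\<^sub>v w" .
  show "(1\<^sub>m a - Y * Z) *\<^sub>v y = v + Y *\<^sub>v w" by (rule eliminate_block[OF Y Z x y v w eqY eqZ])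
  show "(1\<^sub>m b - Z * Y) *\<^sub>v x = w + Z *\<^sub>v v" by (rule eliminate_block[OF Z Y y x w v eqZ eqY])
qed

theorem theorem2p5:
  fixes m n p q k :: nat
    and A B C D Bl Br Cl Cr A\<^sub>\<alpha>\<^sub>\<beta> D\<^sub>\<alpha>\<^sub>\<beta> :: "real mat"
    and u1 u2 v1 v2 v1k v2k :: "real vec"
    and \<alpha> \<beta> \<gamma> :: real
    and U V W Q T S Y Z :: "nat \<Rightarrow> real mat"
  assumes mn: "0 < m" "0 < n"
    and A: "A \<in> carrier_mat m m" and D: "D \<in> carrier_mat n n"
    and B: "B \<in> carrier_mat m n" and C: "C \<in> carrier_mat n m"
    and M_mat: "nonsingular_M_matrix (n + m) (four_block_mat D (- C) (- B) A) \<or>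
      (irreducible_mat (n + m) (four_block_mat D (- C) (- B) A) \<and>
       singular_M_matrix (n + m) (four_block_mat D (- C) (- B) A))"
    and u1: "u1 \<in> carrier_vec n" "\<forall>i<n. 0 < u1 $ i"
    and u2: "u2 \<in> carrier_vec m" "\<forall>i<m. 0 < u2 $ i"
    and v1: "v1 \<in> carrier_vec n" "0\<^sub>v n \<le> v1"
    and v2: "v2 \<in> carrier_vec m" "0\<^sub>v m \<le> v2"
    and triplet: "four_block_mat D (- C) (- B) A *\<^sub>v (u1 @\<^sub>v u2) = v1 @\<^sub>v v2"
    and Bl: "Bl \<in> carrier_mat m p" "0\<^sub>m m p \<le> Bl" "full_column_rank Bl"
    and Br: "Br \<in> carrier_mat n p" "0\<^sub>m n p \<le> Br" "full_column_rank Br"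
    and Cl: "Cl \<in> carrier_mat n q" "0\<^sub>m n q \<le> Cl" "full_column_rank Cl"
    and Cr: "Cr \<in> carrier_mat m q" "0\<^sub>m m q \<le> Cr" "full_column_rank Cr"
    and B_fact: "B = Bl * transpose_mat Br" and C_fact: "C = Cl * transpose_mat Cr"
    and \<alpha>: "0 \<le> \<alpha>" "\<alpha> \<le> Min ((\<lambda>i. inverse (A $$ (i, i))) ` {..<m})"
    and \<beta>: "0 \<le> \<beta>" "\<beta> \<le> Min ((\<lambda>j. inverse (D $$ (j, j))) ` {..<n})"
    and max_pos: "max \<alpha> \<beta> > 0"
    and \<gamma>: "\<gamma> = \<alpha> + \<beta>"
    and A\<^sub>\<alpha>\<^sub>\<beta>: "A\<^sub>\<alpha>\<^sub>\<beta> = minv (shift \<beta> A) * shift (- \<alpha>) A"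
    and D\<^sub>\<alpha>\<^sub>\<beta>: "D\<^sub>\<alpha>\<^sub>\<beta> = minv (shift \<alpha> D) * shift (- \<beta>) D"
    and U: "U 0 = minv (shift \<beta> A) * Bl" "\<And>j. U (Suc j) = A\<^sub>\<alpha>\<^sub>\<beta> * U j"
    and V: "V 0 = transpose_mat (minv (shift \<beta> A)) * Cr"
           "\<And>j. V (Suc j) = transpose_mat A\<^sub>\<alpha>\<^sub>\<beta> * V j"
    and W: "W 0 = minv (shift \<alpha> D) * Cl" "\<And>j. W (Suc j) = D\<^sub>\<alpha>\<^sub>\<beta> * W j"
    and Q: "Q 0 = transpose_mat (minv (shift \<alpha> D)) * Br"
           "\<And>j. Q (Suc j) = transpose_mat D\<^sub>\<alpha>\<^sub>\<beta> * Q j"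
    and T: "\<And>j. T j = transpose_mat (block_row Q (2 ^ j)) * block_row W (2 ^ j)"
    and S: "\<And>j. S j = transpose_mat (block_row V (2 ^ j)) * block_row U (2 ^ j)"
    and Y: "Y 0 = \<alpha> \<cdot>\<^sub>m (transpose_mat Br * minv (shift \<alpha> D) * Cl)"
           "\<And>j. Y (Suc j) =
              four_block_mat (0\<^sub>m (2 ^ j * p) (2 ^ j * q)) (Y j) (Y j) (\<gamma> \<cdot>\<^sub>m T j)"
    and Z: "Z 0 = \<beta> \<cdot>\<^sub>m (transpose_mat Cr * minv (shift \<beta> A) * Bl)"
           "\<And>j. Z (Suc j) =
              four_block_mat (0\<^sub>m (2 ^ j * q) (2 ^ j * p)) (Z j) (Z j) (\<gamma> \<cdot>\<^sub>m S j)"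
    and k: "1 \<le> k"
    and v1k: "v1k = \<alpha> \<cdot>\<^sub>v (ones_vec (2 ^ k) \<otimes>\<^sub>v (transpose_mat (Q 0) *\<^sub>v v1))
        + transpose_mat (block_row Q (2 ^ k)) *\<^sub>v u1
        + \<gamma> \<cdot>\<^sub>v (transpose_mat (block_row (partial_sum Q) (2 ^ k)) *\<^sub>v
                 (minv (shift \<alpha> D) *\<^sub>v v1))"
    and v2k: "v2k = \<beta> \<cdot>\<^sub>v (ones_vec (2 ^ k) \<otimes>\<^sub>v (transpose_mat (V 0) *\<^sub>v v2))
        + transpose_mat (block_row V (2 ^ k)) *\<^sub>v u2
        + \<gamma> \<cdot>\<^sub>v (transpose_mat (block_row (partial_sum V) (2 ^ k)) *\<^sub>v
                 (minv (shift \<beta> A) *\<^sub>v v2))"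
  shows
    "four_block_mat (- Y k) (1\<^sub>m (2 ^ k * p)) (1\<^sub>m (2 ^ k * q)) (- Z k) *\<^sub>v
       ((ones_vec (2 ^ k) \<otimes>\<^sub>v (transpose_mat Cr *\<^sub>v u2)) @\<^sub>v
        (ones_vec (2 ^ k) \<otimes>\<^sub>v (transpose_mat Br *\<^sub>v u1)))
     = v1k @\<^sub>v v2k
     \<and> (1\<^sub>m (2 ^ k * p) - Y k * Z k) *\<^sub>v (ones_vec (2 ^ k) \<otimes>\<^sub>v (transpose_mat Br *\<^sub>v u1))
       = v1k + Y k *\<^sub>v v2k
     \<and> (1\<^sub>m (2 ^ k * q) - Z k * Y k) *\<^sub>v (ones_vec (2 ^ k) \<otimes>\<^sub>v (transpose_mat Cr *\<^sub>v u2))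
       = v2k + Z k *\<^sub>v v1k"
proof -
  let ?M = "four_block_mat D (- C) (- B) A"
  let ?t = transpose_mat
  let ?x = "?t Cr *\<^sub>v u2" and ?y = "?t Br *\<^sub>v u1"
  let ?c = "ones_vec (2 ^ k) \<otimes>\<^sub>v ?x" and ?b = "ones_vec (2 ^ k) \<otimes>\<^sub>v ?y"
  have x: "?x \<in> carrier_vec q" and y: "?y \<in> carrier_vec p"
    using Cr Br u1 u2 by auto
  have "M_matrix (n + m) ?M"
    using M_mat by (auto simp: singular_M_matrix_def nonsingular_M_matrix_def M_matrix_def)
  note off = M_matrix_offdiag_nonpos[OF this]
  have offD: "D $$ (i, j) \<le> 0" if "i < n" "j < n" "i \<noteq> j" for i j
    using off[of i j] that A D by simp
  have offA: "A $$ (i, j) \<le> 0" if "i < m" "j < m" "i \<noteq> j" for i j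
    using off[of "n + i" "n + j"] that A D by simp
  have "?M *\<^sub>v (u1 @\<^sub>v u2) = (D *\<^sub>v u1 + (- C) *\<^sub>v u2) @\<^sub>v ((- B) *\<^sub>v u1 + A *\<^sub>v u2)"
    using A B C D u1 u2 by (intro four_block_mat_mult_vec[of _ n n _ m _ m]) auto
  with triplet have "(D *\<^sub>v u1 + (- C) *\<^sub>v u2) @\<^sub>v ((- B) *\<^sub>v u1 + A *\<^sub>v u2) = v1 @\<^sub>v v2"
    by simp
  then have blocks: "D *\<^sub>v u1 + (- C) *\<^sub>v u2 = v1" "(- B) *\<^sub>v u1 + A *\<^sub>v u2 = v2"
    using append_vec_eq[of "D *\<^sub>v u1 + (- C) *\<^sub>v u2" n v1] A B C D u1 u2 v1 by auto
  have Cu: "C *\<^sub>v u2 = Cl *\<^sub>v ?x"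
    unfolding C_fact using Cl Cr u2 by (intro assoc_mult_mat_vec) auto
  have Bu: "B *\<^sub>v u1 = Bl *\<^sub>v ?y"
    unfolding B_fact using Bl Br u1 by (intro assoc_mult_mat_vec) auto
  have Du: "D *\<^sub>v u1 = v1 + Cl *\<^sub>v ?x"
    unfolding Cu[symmetric] blocks(1)[symmetric] using C D u1 u2
    by (auto simp: vec_eq_iff simp del: index_mult_mat_vec)
  have Au: "A *\<^sub>v u2 = v2 + Bl *\<^sub>v ?y"
    unfolding Bu[symmetric] blocks(2)[symmetric] using A B u1 u2
    by (auto simp: vec_eq_iff simp del: index_mult_mat_vec)
  have u1_pos: "0 < u1 $ i" if "i < n" for i using u1(2) that by blast
  have u2_pos: "0 < u2 $ i" if "i < m" for i using u2(2) that by blast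
  have tr: "?t Cr \<in> carrier_mat q m" "0\<^sub>m q m \<le> ?t Cr" "?t Br \<in> carrier_mat p n" "0\<^sub>m p n \<le> ?t Br"
    using Cr(1,2) Br(1,2) by (auto simp: less_eq_mat_def)
  have Du_nonneg: "0 \<le> (D *\<^sub>v u1) $ i" if "i < n" for i
    using nonneg_mat_mult_vec[OF Cl(1,2) x nonneg_mat_mult_vec[OF tr(1,2) u2(1)] that] u2_pos
      v1 Cl(1) that
    unfolding Du by (auto simp: less_eq_vec_def less_imp_le simp del: index_mult_mat_vec)
  have Au_nonneg: "0 \<le> (A *\<^sub>v u2) $ i" if "i < m" for i
    using nonneg_mat_mult_vec[OF Bl(1,2) y nonneg_mat_mult_vec[OF tr(3,4) u1(1)] that] u1_pos
      v2 Bl(1) that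
    unfolding Au by (auto simp: less_eq_vec_def less_imp_le simp del: index_mult_mat_vec)
  note E = minv_shift[OF D \<alpha>(1) offD u1(1) u1_pos Du_nonneg]
  note F = minv_shift[OF A \<beta>(1) offA u2(1) u2_pos Au_nonneg]
  have sh: "shift t D \<in> carrier_mat n n" "shift t A \<in> carrier_mat m m" for t
    using A D by (auto simp: shift_def)
  interpret dY: doubling n p q D\<^sub>\<alpha>\<^sub>\<beta> Q W T Y \<gamma>
    by unfold_locales
      (use E(3) sh Br(1) Cl(1) in \<open>auto simp: D\<^sub>\<alpha>\<^sub>\<beta> Q W T Y\<close>)
  interpret dZ: doubling m q p A\<^sub>\<alpha>\<^sub>\<beta> V U S Z \<gamma>
    by unfold_locales
      (use F(3) sh Bl(1) Cr(1) in \<open>auto simp: A\<^sub>\<alpha>\<^sub>\<beta> U V S Z\<close>)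
  have eqY: "v1k + Y k *\<^sub>v ?c = ?b"
    by (rule dY.doubling_identity[OF D E(3) E(2) D\<^sub>\<alpha>\<^sub>\<beta> \<gamma> Br(1) Cl(1) Q(1) W(1) Y(1) u1(1) v1(1) x Du v1k])
  have \<gamma>': "\<gamma> = \<beta> + \<alpha>" using \<gamma> by simp
  have eqZ: "v2k + Z k *\<^sub>v ?b = ?c"
    by (rule dZ.doubling_identity[OF A F(3) F(2) A\<^sub>\<alpha>\<^sub>\<beta> \<gamma>' Cr(1) Bl(1) V(1) U(1) Z(1) u2(1) v2(1) y Au v2k])
  let ?P = "2 ^ k * p" and ?R = "2 ^ k * q"
  have b: "?b \<in> carrier_vec ?P" and c: "?c \<in> carrier_vec ?R"
    using Br(1) Cr(1) by (auto simp: kron_vec_def ones_vec_def)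
  have v1k_carrier: "v1k \<in> carrier_vec ?P" and v2k_carrier: "v2k \<in> carrier_vec ?R"
    using dY.Q_carrier[of 0] dZ.Q_carrier[of 0]
    by (auto simp: v1k v2k block_row_def Let_def intro!: carrier_vecI)
  show ?thesis
    using eliminate_coupled_blocks[OF dY.Y_carrier dZ.Y_carrier c b v1k_carrier v2k_carrier eqY eqZ] by blast
qed

end
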